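(* There are absolute constants $c>0$ and $c'>0$ such that for every $N \in \mathbb{N}$ there are a set $A \subset \mathbb{F}_2^\infty$ of size $|A|=N$ and a $k \in \mathbb{N}$ with $k \geq c' N^{\frac{1}{2}+c}$ such that $A$ is not $k$-stable (in $\mathbb{F}_2^\infty$). (That is, there is a set $A$ of size $N$ that is not $\Omega(N^{\frac{1}{2}+c})$-stable.)
   Context: $\mathbb{N}=\{1,2,3,\dots\}$. $\mathbb{F}_2^\infty$ denotes the direct sum of countably many copies of $\mathbb{F}_2$, regarded as an additive Abelian group. Let $G$ be an Abelian group, $A \subset G$ and $k \in \mathbb{N}$. The set $A$ has the $k$-order property (in $G$) if there are vectors $s=(s_1,\dots,s_k)$ and $t=(t_1,\dots,t_k)$ in $G^k$ such that for all $1 \leq i,j \leq k$ one has $s_i+t_j \in A$ if and only if $i \leq j$. The set $A$ is $k$-stable (in $G$) if it does not have the $k$-order property. *)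

theory Defs
  imports Complex_Main "HOL-Library.Z2" "HOL-Library.Poly_Mapping"
begin

text \<open>
  The direct sum of countably many copies of the two-element field: finitely supported
  functions from \<^typ>\<open>nat\<close> to \<^typ>\<open>bit\<close>, with pointwise addition.
\<close>

type_synonym F2_infty = "nat \<Rightarrow>\<^sub>0 bit"

text \<open>
  A vector in $G^k$ is given by a function on \<^typ>\<open>nat\<close> of which only the values at
  $1, \dots, k$ are used.
\<close>

definition k_order_property :: "nat \<Rightarrow> 'a::ab_group_add set \<Rightarrow> bool" where
  "k_order_property k A \<longleftrightarrow>
    (\<exists>s t :: nat \<Rightarrow> 'a. \<forall>i\<in>{1..k}. \<forall>j\<in>{1..k}. s i + t j \<in> A \<longleftrightarrow> i \<le> j)"

definition k_stable :: "nat \<Rightarrow> 'a::ab_group_add set \<Rightarrow> bool" where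
  "k_stable k A \<longleftrightarrow> \<not> k_order_property k A"

end

theory Submission
  imports Defs
begin

unbundle bit_operations_syntax

text \<open>
  A finite order gadget with four pairs $(s_a, t_b)$ is amplified by lexicographic powers.
  In $\mathbb{F}_2^4$ there are $s_0,\dots,s_3$ and $t_0,\dots,t_3$ for which the value of
  $s_a + t_b$ determines which of $a < b$, $a = b$, $a > b$ holds, while only $12 < 4^2$ values
  occur. Using the gadget on each base-4 digit, the sum attached to $i, j < 4^n$ determines how
  the leading differing digits compare, hence whether $i \le j$, and at most $12^n$ sums occur.
  So a set of size at most $12^n$ has the $4^n$-order property, and $\log_{12} 4 > 11/20$.

  All computations take place in the group of natural numbers under bitwise exclusive or, which is
  isomorphic to $\mathbb{F}_2^\infty$ by binary expansion; a block of four bits is a base-16 digit.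
\<close>

section \<open>The gadget on one base-4 digit\<close>

definition \<sigma> :: "nat \<Rightarrow> nat" where
  "\<sigma> a = [0, 1, 4, 6] ! a"

definition \<tau> :: "nat \<Rightarrow> nat" where
  "\<tau> b = [0, 2, 8, 9] ! b"

lemma less_4_cases: "(a::nat) < 4 \<Longrightarrow> a = 0 \<or> a = 1 \<or> a = 2 \<or> a = 3"
  by auto

lemma \<sigma>_less: "a < 4 \<Longrightarrow> \<sigma> a < 16"
  by (auto dest!: less_4_cases simp: \<sigma>_def)

lemma \<tau>_less: "b < 4 \<Longrightarrow> \<tau> b < 16"
  by (auto dest!: less_4_cases simp: \<tau>_def)

text \<open>A check of all 16 pairs. The three classes are disjoint, and the saving from 16 sums to
  12 comes from coincidences within a class: 8 and 9 each arise twice with \<open>a < b\<close>, 4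
  and 6 each twice with \<open>b < a\<close>.\<close>

lemma digit_sum_classes:
  assumes "a < 4" "b < 4"
  shows "a < b \<longleftrightarrow> \<sigma> a XOR \<tau> b \<in> {2, 8, 9, 13}"
    and "a = b \<longleftrightarrow> \<sigma> a XOR \<tau> b \<in> {0, 3, 12, 15}"
    and "b < a \<longleftrightarrow> \<sigma> a XOR \<tau> b \<in> {1, 4, 6, 14}"
  using less_4_cases [OF assms(1)] less_4_cases [OF assms(2)]
  by (elim disjE; simp add: \<sigma>_def \<tau>_def)+

lemma digit_sum_determines_order:
  assumes "a < 4" "b < 4" "a' < 4" "b' < 4" "\<sigma> a XOR \<tau> b = \<sigma> a' XOR \<tau> b'"
  shows "(a < b \<longleftrightarrow> a' < b') \<and> (a = b \<longleftrightarrow> a' = b')"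
  unfolding digit_sum_classes(1,2) [OF assms(1,2)] digit_sum_classes(1,2) [OF assms(3,4)] assms(5)
  by (rule conjI refl)+

definition digit_sums :: "nat set" where
  "digit_sums = {2, 8, 9, 13} \<union> {0, 3, 12, 15} \<union> {1, 4, 6, 14}"

lemma digit_sum_in_digit_sums: "a < 4 \<Longrightarrow> b < 4 \<Longrightarrow> \<sigma> a XOR \<tau> b \<in> digit_sums"
  using digit_sum_classes [of a b] nat_neq_iff [of a b] unfolding digit_sums_def by blast

section \<open>Applying the gadget digit by digit\<close>

lemma xor_base_16:
  fixes x y a b :: nat
  assumes "a < 16" "b < 16"
  shows "(16 * x + a) XOR (16 * y + b) = 16 * (x XOR y) + (a XOR b)"
proof -
  let ?z = "(16 * x + a) XOR (16 * y + b)"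
  \<comment> \<open>XOR acts on each bit separately, without carries, so the lowest four bits and
    the remaining ones can be computed independently.\<close>
  have "drop_bit 4 ?z = x XOR y"
    using assms unfolding drop_bit_xor by (simp add: drop_bit_eq_div)
  moreover have "take_bit 4 ?z = a XOR b"
  proof -
    have "take_bit 4 (16 * x + a) = a" "take_bit 4 (16 * y + b) = b"
      using assms by (simp_all add: take_bit_eq_mod)
    then show ?thesis
      by (simp add: take_bit_xor)
  qed
  ultimately show ?thesis
    using bits_ident [of 4 ?z] by (simp add: push_bit_eq_mult mult.commute)
qed

fun lift_digits :: "(nat \<Rightarrow> nat) \<Rightarrow> nat \<Rightarrow> nat" where
  "lift_digits f i = (if i = 0 then 0 else 16 * lift_digits f (i div 4) + f (i mod 4))"

declare lift_digits.simps [simp del]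

text \<open>Since \<open>f 0 = 0\<close>, leading zeros contribute nothing and the recursion also
  holds at \<open>i = 0\<close>. Hence two indices with different numbers of digits can be peeled in
  parallel.\<close>

lemma lift_digits_rec:
  "f 0 = 0 \<Longrightarrow> lift_digits f i = 16 * lift_digits f (i div 4) + f (i mod 4)"
  by (cases "i = 0") (simp_all add: lift_digits.simps)

definition pair_sum :: "nat \<Rightarrow> nat \<Rightarrow> nat" where
  "pair_sum i j = lift_digits \<sigma> i XOR lift_digits \<tau> j"

lemma pair_sum_rec:
  "pair_sum i j = 16 * pair_sum (i div 4) (j div 4) + (\<sigma> (i mod 4) XOR \<tau> (j mod 4))"
proof -
  have "lift_digits \<sigma> i = 16 * lift_digits \<sigma> (i div 4) + \<sigma> (i mod 4)"
    by (rule lift_digits_rec) (simp add: \<sigma>_def)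
  moreover have "lift_digits \<tau> j = 16 * lift_digits \<tau> (j div 4) + \<tau> (j mod 4)"
    by (rule lift_digits_rec) (simp add: \<tau>_def)
  ultimately show ?thesis
    unfolding pair_sum_def by (simp only: xor_base_16 \<sigma>_less \<tau>_less mod_less_divisor zero_less_numeral)
qed

lemma digit_sum_less: "\<sigma> (i mod 4) XOR \<tau> (j mod 4) < 16"
proof -
  have "\<sigma> (i mod 4) < 2 ^ 4" "\<tau> (j mod 4) < 2 ^ 4"
    using \<sigma>_less \<tau>_less by simp_all
  then have "take_bit 4 (\<sigma> (i mod 4) XOR \<tau> (j mod 4)) = \<sigma> (i mod 4) XOR \<tau> (j mod 4)"
    by (simp add: take_bit_xor take_bit_nat_eq_self)
  then show ?thesis
    using take_bit_nat_less_exp [of 4 "\<sigma> (i mod 4) XOR \<tau> (j mod 4)"] by simp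
qed

section \<open>Recovering the order of the indices from their sum\<close>

lemma less_iff_div_mod_4:
  "(i::nat) < j \<longleftrightarrow> i div 4 < j div 4 \<or> i div 4 = j div 4 \<and> i mod 4 < j mod 4"
proof -
  have "4 * p + a < 4 * q + b \<longleftrightarrow> p < q \<or> p = q \<and> a < b"
    if "a < 4" "b < 4" for p q a b :: nat
    using that by linarith
  from this [of "i mod 4" "j mod 4" "i div 4" "j div 4"] show ?thesis
    by simp
qed

lemma eq_iff_div_mod_4: "(i::nat) = j \<longleftrightarrow> i div 4 = j div 4 \<and> i mod 4 = j mod 4"
  by (metis div_mult_mod_eq)

text \<open>Induction removes the lowest digit of all four indices at once. The order is
  lexicographic in quotient and digit, so equality must be carried along with \<open><\<close>: a
  tie of the quotients hands the decision to the last digit.\<close>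

lemma pair_sum_determines_order:
  assumes "pair_sum i j = pair_sum i' j'"
  shows "(i < j \<longleftrightarrow> i' < j') \<and> (i = j \<longleftrightarrow> i' = j')"
  using assms
proof (induction "i + j + i' + j'" arbitrary: i j i' j' rule: less_induct)
  case less
  show ?case
  proof (cases "i + j + i' + j' = 0")
    case False
    have eq: "16 * pair_sum (i div 4) (j div 4) + (\<sigma> (i mod 4) XOR \<tau> (j mod 4))
        = 16 * pair_sum (i' div 4) (j' div 4) + (\<sigma> (i' mod 4) XOR \<tau> (j' mod 4))"
      using less.prems pair_sum_rec by metis
    have "i div 4 + j div 4 + i' div 4 + j' div 4 < i + j + i' + j'"
    proof -
      \<comment> \<open>Division by 4 increases no index and strictly decreases each positive one,
        and at least one of the four is positive.\<close>
      have less: "p + q + p' + q' < i + j + i' + j'"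
        if "p \<le> i \<and> (i = 0 \<or> p < i)" "q \<le> j \<and> (j = 0 \<or> q < j)"
          "p' \<le> i' \<and> (i' = 0 \<or> p' < i')" "q' \<le> j' \<and> (j' = 0 \<or> q' < j')" for p q p' q'
        using that False by linarith
      show ?thesis
        by (rule less) auto
    qed
    \<comment> \<open>Both low parts are below 16, so equality splits into quotients and remainders
      modulo 16.\<close>
    moreover have high: "pair_sum (i div 4) (j div 4) = pair_sum (i' div 4) (j' div 4)"
      using eq digit_sum_less [of i j] digit_sum_less [of i' j'] by linarith
    ultimately have "(i div 4 < j div 4 \<longleftrightarrow> i' div 4 < j' div 4)
        \<and> (i div 4 = j div 4 \<longleftrightarrow> i' div 4 = j' div 4)"
      by (rule less.hyps)
    moreover have "\<sigma> (i mod 4) XOR \<tau> (j mod 4) = \<sigma> (i' mod 4) XOR \<tau> (j' mod 4)"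
      using eq high by simp
    then have "(i mod 4 < j mod 4 \<longleftrightarrow> i' mod 4 < j' mod 4)
        \<and> (i mod 4 = j mod 4 \<longleftrightarrow> i' mod 4 = j' mod 4)"
      by (intro digit_sum_determines_order) simp_all
    ultimately show ?thesis
      unfolding less_iff_div_mod_4 [of i j] less_iff_div_mod_4 [of i' j']
        eq_iff_div_mod_4 [of i j] eq_iff_div_mod_4 [of i' j'] by blast
  qed simp
qed

lemma pair_sum_determines_le:
  "pair_sum i j = pair_sum i' j' \<Longrightarrow> i \<le> j \<longleftrightarrow> i' \<le> j'"
  using pair_sum_determines_order [of i j i' j'] by (auto simp: le_less)

section \<open>Counting the sums\<close>

definition pair_sums :: "nat \<Rightarrow> nat set" where
  "pair_sums n = (\<lambda>(i, j). pair_sum i j) ` ({..<4 ^ n} \<times> {..<4 ^ n})"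

lemma finite_pair_sums: "finite (pair_sums n)"
  by (simp add: pair_sums_def)

text \<open>Each additional digit multiplies the bound by 12: a sum for \<open>Suc n\<close> digits
  is a sum for \<open>n\<close> digits followed by one element of \<open>digit_sums\<close>.\<close>

lemma card_pair_sums: "card (pair_sums n) \<le> 12 ^ n"
proof (induction n)
  case 0
  show ?case
    by (simp add: pair_sums_def lessThan_Suc)
next
  case (Suc n)
  have "pair_sums (Suc n) \<subseteq> (\<lambda>(x, d). 16 * x + d) ` (pair_sums n \<times> digit_sums)"
  proof
    fix x
    assume "x \<in> pair_sums (Suc n)"
    then obtain i j where ij: "i < 4 * 4 ^ n" "j < 4 * 4 ^ n" and x: "x = pair_sum i j"
      by (auto simp: pair_sums_def)
    from ij have "i div 4 < 4 ^ n" "j div 4 < 4 ^ n"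
      by (simp_all add: less_mult_imp_div_less mult.commute)
    then have "pair_sum (i div 4) (j div 4) \<in> pair_sums n"
      by (auto simp: pair_sums_def)
    moreover have "\<sigma> (i mod 4) XOR \<tau> (j mod 4) \<in> digit_sums"
      by (simp add: digit_sum_in_digit_sums)
    ultimately show "x \<in> (\<lambda>(x, d). 16 * x + d) ` (pair_sums n \<times> digit_sums)"
      unfolding x by (subst pair_sum_rec) force
  qed
  then have "card (pair_sums (Suc n)) \<le> card (pair_sums n \<times> digit_sums)"
    by (rule surj_card_le [rotated]) (simp add: finite_pair_sums digit_sums_def)
  also have "\<dots> \<le> 12 ^ Suc n"
    using Suc by (simp add: card_cartesian_product digit_sums_def)
  finally show ?case .
qed

section \<open>Transfer to the direct sum and sets of prescribed size\<close>

lift_definition F2_of_nat :: "nat \<Rightarrow> F2_infty" is "\<lambda>x n. of_bool (bit x n)"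
proof -
  fix x :: nat
  \<comment> \<open>The support is finite because a nonzero bit at position \<open>n\<close> forces
    \<open>n < 2 ^ n \<le> x\<close>.\<close>
  have "{n. of_bool (bit x n) \<noteq> (0::bit)} \<subseteq> {..<x}"
  proof
    fix n
    assume "n \<in> {n. of_bool (bit x n) \<noteq> (0::bit)}"
    then have "x div 2 ^ n \<noteq> 0"
      by (auto simp: bit_iff_odd elim!: oddE)
    then have "2 ^ n \<le> x"
      by (simp add: div_eq_0_iff)
    then show "n \<in> {..<x}"
      using less_exp [of n] by (simp del: less_exp)
  qed
  then show "finite {n. of_bool (bit x n) \<noteq> (0::bit)}"
    by (rule finite_subset) simp
qed

lemma F2_of_nat_xor: "F2_of_nat (x XOR y) = F2_of_nat x + F2_of_nat y"
  by transfer (auto simp: fun_eq_iff bit_xor_iff)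

lemma inj_F2_of_nat: "inj F2_of_nat"
proof (rule injI)
  fix x y
  assume "F2_of_nat x = F2_of_nat y"
  then have "of_bool (bit x n) = (of_bool (bit y n) :: bit)" for n
    by transfer metis
  then show "x = y"
    by (intro bit_eqI) (simp add: of_bool_eq_iff)
qed

text \<open>Used to pad the set of required sums to exactly \<open>N\<close> elements without
  admitting a forbidden sum.\<close>

lemma exists_superset_avoiding:
  fixes A B :: "'a set"
  assumes "infinite (UNIV :: 'a set)" "finite A" "finite B" "A \<inter> B = {}" "card A \<le> N"
  obtains C where "A \<subseteq> C" "C \<inter> B = {}" "finite C" "card C = N"
proof -
  have "infinite (UNIV - (A \<union> B))"
    using assms by (simp add: Diff_infinite_finite)
  then obtain D where D: "finite D" "card D = N - card A" "D \<subseteq> UNIV - (A \<union> B)"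
    using infinite_arbitrarily_large by blast
  show thesis
  proof
    show "card (A \<union> D) = N"
      using D assms by (subst card_Un_disjoint) auto
  qed (use D assms in auto)
qed

lemma exists_k_order_property:
  assumes "12 ^ n \<le> N"
  shows "\<exists>A :: F2_infty set. finite A \<and> card A = N \<and> k_order_property (4 ^ n) A"
proof -
  \<comment> \<open>\<open>P\<close> indexes the sums that must lie in the set and \<open>Q\<close>
    those that must stay outside; the images are disjoint because a sum determines whether
    \<open>i \<le> j\<close>.\<close>
  define P where "P = {(i, j). i < 4 ^ n \<and> j < 4 ^ n \<and> i \<le> (j::nat)}"
  define Q where "Q = {(i, j). i < 4 ^ n \<and> j < 4 ^ n \<and> \<not> i \<le> (j::nat)}"
  define f where "f = (\<lambda>(i, j). F2_of_nat (pair_sum i j))"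
  have sub: "P \<subseteq> {..<4 ^ n} \<times> {..<4 ^ n}" "Q \<subseteq> {..<4 ^ n} \<times> {..<4 ^ n}"
    by (auto simp: P_def Q_def)
  have fin: "finite (f ` P)" "finite (f ` Q)"
    using sub by (meson finite_SigmaI finite_imageI finite_lessThan finite_subset)+
  have disj: "f ` P \<inter> f ` Q = {}"
  proof -
    have "pair_sum i j \<noteq> pair_sum i' j'" if "(i, j) \<in> P" "(i', j') \<in> Q" for i j i' j'
      using that pair_sum_determines_le [of i j i' j'] by (auto simp: P_def Q_def)
    then show ?thesis
      by (auto simp: f_def inj_eq [OF inj_F2_of_nat])
  qed
  have "f ` P \<subseteq> F2_of_nat ` pair_sums n"
    by (auto simp: P_def f_def pair_sums_def)
  then have "card (f ` P) \<le> card (pair_sums n)"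
    by (rule surj_card_le [OF finite_pair_sums])
  also have "\<dots> \<le> N"
    using card_pair_sums assms by (rule order_trans)
  finally have card: "card (f ` P) \<le> N" .
  have inf: "infinite (UNIV :: F2_infty set)"
    using inj_F2_of_nat finite_imageD [of F2_of_nat UNIV] finite_subset [of "range F2_of_nat" UNIV]
    by auto
  obtain A where A: "f ` P \<subseteq> A" "A \<inter> f ` Q = {}" "finite A" "card A = N"
    using exists_superset_avoiding [OF inf fin disj card] .
  \<comment> \<open>The order property counts indices from 1, the digit expansions from 0.\<close>
  define s where "s i = F2_of_nat (lift_digits \<sigma> (i - 1))" for i
  define t where "t i = F2_of_nat (lift_digits \<tau> (i - 1))" for i
  have "s i + t j \<in> A \<longleftrightarrow> i \<le> j" if "i \<in> {1..4 ^ n}" "j \<in> {1..4 ^ n}" for i j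
  proof -
    have sum: "s i + t j = f (i - 1, j - 1)"
      by (simp add: s_def t_def f_def pair_sum_def F2_of_nat_xor)
    show ?thesis
    proof (cases "i \<le> j")
      case True
      then have "(i - 1, j - 1) \<in> P"
        using that by (auto simp: P_def)
      with A(1) sum True show ?thesis
        by auto
    next
      case False
      then have "(i - 1, j - 1) \<in> Q"
        using that by (auto simp: Q_def)
      with A(2) sum False show ?thesis
        by auto
    qed
  qed
  then have "k_order_property (4 ^ n) A"
    unfolding k_order_property_def by (intro exI [of _ s] exI [of _ t]) simp
  with A(3,4) show ?thesis
    by (intro exI [of _ A]) simp
qed

section \<open>The exponent and arbitrary sizes\<close>

lemma powr_le_four_power:
  assumes "real N \<le> 12 ^ m"
  shows "real N powr (11 / 20) \<le> 4 ^ m"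
proof (cases "N = 0")
  case False
  have "real N ^ 11 \<le> (12 ^ m) ^ 11"
    using assms by (intro power_mono) auto
  also have "\<dots> = (12 ^ 11) ^ m"
    by (simp only: power_mult [symmetric] mult.commute)
  \<comment> \<open>The exponent 11/20 rests on the numerical inequality
    \<open>12 ^ 11 \<le> 4 ^ 20\<close>.\<close>
  also have "\<dots> \<le> (4 ^ 20 :: real) ^ m"
    by (intro power_mono) simp_all
  also have "\<dots> = (4 ^ m) ^ 20"
    by (simp only: power_mult [symmetric] mult.commute)
  finally have *: "real N ^ 11 \<le> (4 ^ m) ^ 20" .
  have "(real N powr (11 / 20)) ^ 20 = real N ^ 11"
    using False by (simp add: powr_power)
  with * have "(real N powr (11 / 20)) ^ 20 \<le> (4 ^ m) ^ 20"
    by (simp only:)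
  then show ?thesis
    by (subst (asm) power_mono_iff) simp_all
qed simp

theorem proposition1p4:
  "\<exists>c c' :: real. c > 0 \<and> c' > 0 \<and>
    (\<forall>N::nat. N \<ge> 1 \<longrightarrow>
      (\<exists>(A :: F2_infty set) (k::nat).
        finite A \<and> card A = N \<and> k \<ge> 1 \<and>
        real k \<ge> c' * real N powr (1 / 2 + c) \<and> \<not> k_stable k A))"
proof (rule exI [of _ "1 / 20"], rule exI [of _ "1 / 4"], intro conjI allI impI)
  fix N :: nat
  assume "N \<ge> 1"
  \<comment> \<open>Rounding \<open>N\<close> down to a power of 12 gives \<open>k = 4 ^ n\<close>,
    whereas the upper bound on \<open>N\<close> involves \<open>4 ^ (n + 1)\<close>; the constant
    1/4 absorbs this factor, and 1/20 is 11/20 - 1/2.\<close>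
  then obtain n where n: "12 ^ n \<le> N" "N < 12 ^ (n + 1)"
    using ex_power_ivl1 [of 12 N] by auto
  obtain A :: "F2_infty set" where A: "finite A" "card A = N" "k_order_property (4 ^ n) A"
    using exists_k_order_property [OF n(1)] by blast
  have "real N < real (12 ^ (n + 1))"
    using n(2) by (simp only: of_nat_less_iff)
  then have "real N powr (11 / 20) \<le> 4 ^ (n + 1)"
    by (intro powr_le_four_power) simp
  then have "1 / 4 * real N powr (1 / 2 + 1 / 20) \<le> real (4 ^ n)"
    by simp
  with A show "\<exists>(A :: F2_infty set) (k::nat). finite A \<and> card A = N \<and> k \<ge> 1 \<and>
      real k \<ge> 1 / 4 * real N powr (1 / 2 + 1 / 20) \<and> \<not> k_stable k A"
    by (intro exI [of _ A] exI [of _ "4 ^ n"]) (simp add: k_stable_def)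
qed simp_all

end
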